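(* Let $n>2$, $1\le m<n$ with $2m\neq n$, and let $t$ be a real number with $t\neq 0,1,-1$. Let $(\phi_m,V_m)$ be the following representation of the braid group $\mathbb{B}_n$: $V_m$ is the complex vector space with basis $\{v_x : x\in X_m\}$, where $X_m$ is the set of $n$-tuples in $\{0,1\}^n$ with exactly $m$ coordinates equal to $1$, and $$\phi_m(\tau_k)v_x=q_{x_k,x_{k+1}}\,v_{\sigma_k(x)},\qquad q_{x_k,x_{k+1}}=\begin{cases}1 & \text{if } x_k=x_{k+1},\\ t & \text{if } x_k\neq x_{k+1},\end{cases}$$ for $1\le k\le n-1$, $x\in X_m$, where $\sigma_k(x)$ is obtained from $x$ by exchanging the coordinates $x_k$ and $x_{k+1}$. Then $(\phi_m,V_m)$ is an irreducible representation of $\mathbb{B}_n$ of dimension $\binom{n}{m}$ and corank $\dfrac{2(n-2)!}{(m-1)!\,(n-m-1)!}$.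
   Context: The braid group $\mathbb{B}_n$ on $n$ strings is the group with generators $\tau_1,\dots,\tau_{n-1}$ and relations $\tau_k\tau_j=\tau_j\tau_k$ if $|k-j|>1$, and $\tau_k\tau_{k+1}\tau_k=\tau_{k+1}\tau_k\tau_{k+1}$ for $1\le k\le n-2$. A representation of $\mathbb{B}_n$ is a pair $(\phi,V)$ with $V$ a finite dimensional complex vector space and $\phi:\mathbb{B}_n\to\operatorname{Aut}(V)$ a group homomorphism; the formula for $\phi_m(\tau_k)$ defines a representation of $\mathbb{B}_n$. The corank of a finite dimensional representation $\phi$ of $\mathbb{B}_n$ is the rank of $\phi(\tau_k)-1$ (where $1$ is the identity operator); it does not depend on $k$ because all the $\tau_k$ are conjugate to each other in $\mathbb{B}_n$. *)

theory Defs
  imports Complex_Main "HOL-Library.Function_Algebras" "HOL-Library.FuncSet"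
    "HOL-Combinatorics.Transposition" "HOL-Algebra.Group"
begin

section \<open>Groups given by generators and relations\<close>

text \<open>In a word, the letter \<open>(a, True)\<close> stands for the generator \<open>a\<close> and
  \<open>(a, False)\<close> for its inverse.\<close>

type_synonym 'g word = "('g \<times> bool) list"

abbreviation words :: "'g set \<Rightarrow> 'g word set" where
  "words S \<equiv> lists (S \<times> UNIV)"

inductive pres_eq :: "'g set \<Rightarrow> ('g word \<times> 'g word) set \<Rightarrow> 'g word \<Rightarrow> 'g word \<Rightarrow> bool"
  for S R where
  refl: "w \<in> words S \<Longrightarrow> pres_eq S R w w"
| sym: "pres_eq S R u v \<Longrightarrow> pres_eq S R v u"
| trans: "pres_eq S R u v \<Longrightarrow> pres_eq S R v w \<Longrightarrow> pres_eq S R u w"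
| app: "pres_eq S R u u' \<Longrightarrow> pres_eq S R v v' \<Longrightarrow> pres_eq S R (u @ v) (u' @ v')"
| cancel: "a \<in> S \<Longrightarrow> pres_eq S R [(a, b), (a, \<not> b)] []"
| rel: "(u, v) \<in> R \<Longrightarrow> u \<in> words S \<Longrightarrow> v \<in> words S \<Longrightarrow> pres_eq S R u v"

definition pres_class :: "'g set \<Rightarrow> ('g word \<times> 'g word) set \<Rightarrow> 'g word \<Rightarrow> 'g word set" where
  "pres_class S R w = {w'. pres_eq S R w w'}"

definition presented_group :: "'g set \<Rightarrow> ('g word \<times> 'g word) set \<Rightarrow> 'g word set monoid" where
  "presented_group S R =
    \<lparr>carrier = pres_class S R ` words S,
     monoid.mult = (\<lambda>A B. {w. \<exists>a\<in>A. \<exists>b\<in>B. pres_eq S R (a @ b) w}),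
     one = pres_class S R []\<rparr>"

definition pres_gen :: "'g set \<Rightarrow> ('g word \<times> 'g word) set \<Rightarrow> 'g \<Rightarrow> 'g word set" where
  "pres_gen S R a = pres_class S R [(a, True)]"

primrec word_eval :: "('h, 'b) monoid_scheme \<Rightarrow> ('g \<Rightarrow> 'h) \<Rightarrow> 'g word \<Rightarrow> 'h" where
  "word_eval G f [] = \<one>\<^bsub>G\<^esub>"
| "word_eval G f (l # w) =
    (if snd l then f (fst l) else inv\<^bsub>G\<^esub> (f (fst l))) \<otimes>\<^bsub>G\<^esub> word_eval G f w"

text \<open>The homomorphism determined by the images of the generators. If these images satisfy
  the relations, all words in a class have the same value; see \<open>pres_lift_hom\<close> and
  \<open>pres_lift_gen\<close>.\<close>

definition pres_lift :: "('h, 'b) monoid_scheme \<Rightarrow> ('g \<Rightarrow> 'h) \<Rightarrow> 'g word set \<Rightarrow> 'h" where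
  "pres_lift G f C = the_elem (word_eval G f ` C)"

lemma pres_eq_words: "pres_eq S R u v \<Longrightarrow> u \<in> words S \<and> v \<in> words S"
  by (induction rule: pres_eq.induct) auto

lemma pres_class_eq:
  assumes "pres_eq S R u v" shows "pres_class S R u = pres_class S R v"
  using assms pres_eq.sym pres_eq.trans unfolding pres_class_def by blast

lemma pres_class_mult:
  assumes "u \<in> words S" "v \<in> words S"
  shows "pres_class S R u \<otimes>\<^bsub>presented_group S R\<^esub> pres_class S R v = pres_class S R (u @ v)"
proof -
  have "(\<exists>a\<in>pres_class S R u. \<exists>b\<in>pres_class S R v. pres_eq S R (a @ b) w) \<longleftrightarrow>
      pres_eq S R (u @ v) w" (is "?L \<longleftrightarrow> ?M") for w
  proof
    assume ?L
    then obtain a b where "pres_eq S R u a" "pres_eq S R v b" and w: "pres_eq S R (a @ b) w"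
      by (auto simp: pres_class_def)
    then have "pres_eq S R (u @ v) (a @ b)" by (intro pres_eq.app)
    from pres_eq.trans[OF this w] show ?M .
  next
    assume ?M
    then show ?L using pres_eq.refl[OF assms(1)] pres_eq.refl[OF assms(2)]
      unfolding pres_class_def by blast
  qed
  then show ?thesis
    unfolding presented_group_def pres_class_def[of S R "u @ v"] by simp
qed

definition word_inv :: "'g word \<Rightarrow> 'g word" where
  "word_inv w = rev (map (\<lambda>(a, b). (a, \<not> b)) w)"

lemma word_inv_words: "w \<in> words S \<Longrightarrow> word_inv w \<in> words S"
  by (auto simp: word_inv_def)

lemma word_inv_cancel: "w \<in> words S \<Longrightarrow> pres_eq S R (word_inv w @ w) []"
proof (induction w)
  case Nil
  then show ?case by (simp add: word_inv_def pres_eq.refl)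
next
  case (Cons l w)
  obtain a b where l: "l = (a, b)" by (cases l)
  have aS: "a \<in> S" and w: "w \<in> words S" using Cons.prems l by auto
  have "pres_eq S R ([(a, \<not> b), (a, b)] @ w) ([] @ w)"
    using pres_eq.app[OF pres_eq.cancel[OF aS, of R "\<not> b"] pres_eq.refl[OF w]] by simp
  then have "pres_eq S R (word_inv w @ [(a, \<not> b), (a, b)] @ w) (word_inv w @ [] @ w)"
    using pres_eq.app[OF pres_eq.refl[OF word_inv_words[OF w]]] by blast
  then have "pres_eq S R (word_inv (l # w) @ l # w) (word_inv w @ w)"
    by (simp add: l word_inv_def)
  from pres_eq.trans[OF this Cons.IH[OF w]] show ?case .
qed

lemma presented_group_is_group: "group (presented_group S R)"
proof (rule groupI)
  let ?G = "presented_group S R"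
  have car: "carrier ?G = pres_class S R ` words S"
    and one: "\<one>\<^bsub>?G\<^esub> = pres_class S R []"
    by (auto simp: presented_group_def)
  show "\<one>\<^bsub>?G\<^esub> \<in> carrier ?G" by (auto simp: car one)
  fix x assume x: "x \<in> carrier ?G"
  then obtain u where u: "u \<in> words S" "x = pres_class S R u" by (auto simp: car)
  show "\<one>\<^bsub>?G\<^esub> \<otimes>\<^bsub>?G\<^esub> x = x"
    using pres_class_mult[of "[]" S u R] u by (simp add: one)
  show "\<exists>y\<in>carrier ?G. y \<otimes>\<^bsub>?G\<^esub> x = \<one>\<^bsub>?G\<^esub>"
    using pres_class_mult[OF word_inv_words[OF u(1)] u(1), of R]
      pres_class_eq[OF word_inv_cancel[OF u(1)], of R] u word_inv_words[OF u(1)]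
    by (auto simp: car one)
  fix y assume y: "y \<in> carrier ?G"
  then obtain v where v: "v \<in> words S" "y = pres_class S R v" by (auto simp: car)
  show "x \<otimes>\<^bsub>?G\<^esub> y \<in> carrier ?G"
    using u v pres_class_mult[OF u(1) v(1), of R] by (auto simp: car)
  fix z assume "z \<in> carrier ?G"
  then obtain w where w: "w \<in> words S" "z = pres_class S R w" by (auto simp: car)
  show "x \<otimes>\<^bsub>?G\<^esub> y \<otimes>\<^bsub>?G\<^esub> z = x \<otimes>\<^bsub>?G\<^esub> (y \<otimes>\<^bsub>?G\<^esub> z)"
    using u(1) v(1) w(1) by (simp add: u(2) v(2) w(2) pres_class_mult)
qed

context
  fixes G :: "('h, 'b) monoid_scheme" and f :: "'g \<Rightarrow> 'h" and S :: "'g set"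
    and R :: "('g word \<times> 'g word) set"
  assumes G: "group G" and f: "\<And>a. a \<in> S \<Longrightarrow> f a \<in> carrier G"
begin

lemma word_eval_closed: "w \<in> words S \<Longrightarrow> word_eval G f w \<in> carrier G"
proof (induction w)
  case (Cons l w)
  interpret group G by (rule G)
  show ?case using Cons by (cases l) (auto simp: f)
qed (simp add: G group.is_monoid monoid.one_closed)

lemma word_eval_append:
  "u \<in> words S \<Longrightarrow> v \<in> words S \<Longrightarrow>
    word_eval G f (u @ v) = word_eval G f u \<otimes>\<^bsub>G\<^esub> word_eval G f v"
proof (induction u)
  case Nil
  then show ?case by (simp add: G group.is_monoid monoid.l_one word_eval_closed)
next
  case (Cons l u)
  interpret group G by (rule G)
  have "word_eval G f u \<in> carrier G" "word_eval G f v \<in> carrier G"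
    using Cons.prems word_eval_closed[of u] word_eval_closed[of v] by auto
  then show ?case using Cons by (cases l) (auto simp: f m_assoc)
qed

context
  assumes R: "\<And>u v. (u, v) \<in> R \<Longrightarrow> word_eval G f u = word_eval G f v"
begin

lemma word_eval_pres_eq: "pres_eq S R u v \<Longrightarrow> word_eval G f u = word_eval G f v"
proof (induction rule: pres_eq.induct)
  case (app u u' v v')
  then show ?case using pres_eq_words[OF app.hyps(1)] pres_eq_words[OF app.hyps(2)]
    by (simp add: word_eval_append)
next
  case (cancel a b)
  interpret group G by (rule G)
  show ?case using cancel by (simp add: f)
next
  case (rel u v)
  show ?case using rel.hyps(1) by (rule R)
qed simp_all

lemma pres_lift_class:
  assumes "w \<in> words S" shows "pres_lift G f (pres_class S R w) = word_eval G f w"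
proof -
  have "word_eval G f v = word_eval G f w" if "v \<in> pres_class S R w" for v
    using word_eval_pres_eq[of w v] that by (simp add: pres_class_def)
  moreover have "w \<in> pres_class S R w" using assms by (simp add: pres_class_def pres_eq.refl)
  ultimately have "word_eval G f ` pres_class S R w = {word_eval G f w}" by blast
  then show ?thesis by (simp add: pres_lift_def)
qed

lemma pres_lift_hom: "pres_lift G f \<in> hom (presented_group S R) G"
proof (rule homI)
  fix x assume "x \<in> carrier (presented_group S R)"
  then obtain u where u: "u \<in> words S" "x = pres_class S R u"
    by (auto simp: presented_group_def)
  then show "pres_lift G f x \<in> carrier G" by (simp add: pres_lift_class word_eval_closed)
  fix y assume "y \<in> carrier (presented_group S R)"
  then obtain v where v: "v \<in> words S" "y = pres_class S R v"
    by (auto simp: presented_group_def)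
  have "u @ v \<in> words S" using u v by simp
  then show "pres_lift G f (x \<otimes>\<^bsub>presented_group S R\<^esub> y) = pres_lift G f x \<otimes>\<^bsub>G\<^esub> pres_lift G f y"
    using u(1) v(1)
    by (simp only: u(2) v(2) pres_class_mult pres_lift_class word_eval_append)
qed

lemma pres_lift_gen: "a \<in> S \<Longrightarrow> pres_lift G f (pres_gen S R a) = f a"
  unfolding pres_gen_def by (subst pres_lift_class) (auto simp: f G group.is_monoid monoid.r_one)

end
end

section \<open>The braid group and its representations\<close>

definition braid_rels :: "nat \<Rightarrow> (nat word \<times> nat word) set" where
  "braid_rels n =
    {([(k, True), (j, True)], [(j, True), (k, True)]) | k j.
       k \<in> {1..<n} \<and> j \<in> {1..<n} \<and> \<bar>int k - int j\<bar> > 1} \<union>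
    {([(k, True), (k+1, True), (k, True)], [(k+1, True), (k, True), (k+1, True)]) | k.
       1 \<le> k \<and> k + 2 \<le> n}"

definition braid_group :: "nat \<Rightarrow> nat word set monoid" where
  "braid_group n = presented_group {1..<n} (braid_rels n)"

definition braid_gen :: "nat \<Rightarrow> nat \<Rightarrow> nat word set" where
  "braid_gen n k = pres_gen {1..<n} (braid_rels n) k"

lemma braid_group_is_group: "group (braid_group n)"
  unfolding braid_group_def by (rule presented_group_is_group)

text \<open>Representation spaces are subspaces \<open>V\<close> of an ambient vector space; automorphisms of
  \<open>V\<close> are functions with value \<open>undefined\<close> outside \<open>V\<close>.\<close>

locale complex_vector_space = vector_space scale
  for scale :: "complex \<Rightarrow> 'b :: ab_group_add \<Rightarrow> 'b"  (infixr \<open>*s\<close> 75)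
begin

definition Aut_group :: "'b set \<Rightarrow> ('b \<Rightarrow> 'b) monoid" where
  "Aut_group V =
    \<lparr>carrier = {f \<in> extensional V. bij_betw f V V \<and>
        (\<forall>u\<in>V. \<forall>v\<in>V. f (u + v) = f u + f v) \<and> (\<forall>c. \<forall>v\<in>V. f (c *s v) = c *s f v)},
     monoid.mult = compose V,
     one = (\<lambda>v\<in>V. v)\<rparr>"

definition braid_rep :: "nat \<Rightarrow> 'b set \<Rightarrow> (nat word set \<Rightarrow> 'b \<Rightarrow> 'b) \<Rightarrow> bool" where
  "braid_rep n V \<phi> \<longleftrightarrow>
    subspace V \<and> (\<exists>B. finite B \<and> V = span B) \<and> \<phi> \<in> hom (braid_group n) (Aut_group V)"

definition irreducible_braid_rep :: "nat \<Rightarrow> 'b set \<Rightarrow> (nat word set \<Rightarrow> 'b \<Rightarrow> 'b) \<Rightarrow> bool" where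
  "irreducible_braid_rep n V \<phi> \<longleftrightarrow>
    braid_rep n V \<phi> \<and> V \<noteq> {0} \<and>
    (\<forall>W. subspace W \<and> W \<subseteq> V \<and> (\<forall>g\<in>carrier (braid_group n). \<phi> g ` W \<subseteq> W)
      \<longrightarrow> W = {0} \<or> W = V)"

text \<open>The rank of \<open>\<phi> (\<tau>\<^sub>k) - 1\<close> on \<open>V\<close>; it does not depend on \<open>k\<close>, because the generators are
  conjugate to each other.\<close>

definition corank :: "nat \<Rightarrow> 'b set \<Rightarrow> (nat word set \<Rightarrow> 'b \<Rightarrow> 'b) \<Rightarrow> nat \<Rightarrow> nat" where
  "corank n V \<phi> k = dim ((\<lambda>v. \<phi> (braid_gen n k) v - v) ` V)"

lemma Aut_group_is_group:
  assumes V: "subspace V" shows "group (Aut_group V)"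
proof (rule groupI)
  let ?G = "Aut_group V"
  fix f assume f: "f \<in> carrier ?G"
  have bf: "bij_betw f V V" using f by (simp add: Aut_group_def)
  have fV: "f v \<in> V" if "v \<in> V" for v using bf that by (auto simp: bij_betw_def)
  show "\<one>\<^bsub>?G\<^esub> \<otimes>\<^bsub>?G\<^esub> f = f"
    using f by (auto simp: Aut_group_def compose_def fV fun_eq_iff extensional_def)
  define g where "g = restrict (inv_into V f) V"
  have gV: "g v \<in> V" and fg: "f (g v) = v" if "v \<in> V" for v
    using bf that by (auto simp: g_def bij_betw_def inv_into_into f_inv_into_f)
  have gf: "g (f v) = v" if "v \<in> V" for v
    using bf that by (auto simp: g_def bij_betw_def inv_into_into f_inv_into_f)
  have bg: "bij_betw g V V"
    by (rule bij_betw_byWitness[where f' = f]) (auto simp: gf fg fV gV)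
  have add: "g (u + v) = g u + g v" if "u \<in> V" "v \<in> V" for u v
  proof -
    have "f (g u + g v) = u + v" using f that gV by (simp add: Aut_group_def fg)
    then show ?thesis using gf[of "g u + g v"] gV that subspace_add[OF V] by metis
  qed
  have sc: "g (c *s v) = c *s g v" if "v \<in> V" for c v
  proof -
    have "f (c *s g v) = c *s v" using f that gV by (simp add: Aut_group_def fg)
    then show ?thesis using gf[of "c *s g v"] gV that subspace_scale[OF V] by metis
  qed
  have "g \<in> carrier ?G"
    using bg add sc by (simp add: Aut_group_def) (simp add: g_def)
  moreover have "g \<otimes>\<^bsub>?G\<^esub> f = \<one>\<^bsub>?G\<^esub>"
    by (auto simp: Aut_group_def compose_def gf fun_eq_iff)
  ultimately show "\<exists>h\<in>carrier ?G. h \<otimes>\<^bsub>?G\<^esub> f = \<one>\<^bsub>?G\<^esub>" by blast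
  fix h assume h: "h \<in> carrier ?G"
  have bh: "bij_betw h V V" using h by (simp add: Aut_group_def)
  have hV: "h v \<in> V" if "v \<in> V" for v using bh that by (auto simp: bij_betw_def)
  have "bij_betw (compose V f h) V V" using bij_betw_compose[OF bh bf] .
  then show "f \<otimes>\<^bsub>?G\<^esub> h \<in> carrier ?G"
    using f h subspace_add[OF V] subspace_scale[OF V] hV
    by (simp add: Aut_group_def) (simp add: compose_def)
  fix k assume k: "k \<in> carrier ?G"
  then have kV: "k v \<in> V" if "v \<in> V" for v using that
    by (auto simp: Aut_group_def bij_betw_def)
  show "f \<otimes>\<^bsub>?G\<^esub> h \<otimes>\<^bsub>?G\<^esub> k = f \<otimes>\<^bsub>?G\<^esub> (h \<otimes>\<^bsub>?G\<^esub> k)"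
    by (auto simp: Aut_group_def compose_def fun_eq_iff kV)
next
  show "\<one>\<^bsub>Aut_group V\<^esub> \<in> carrier (Aut_group V)"
    using subspace_add[OF V] subspace_scale[OF V]
    by (auto simp: Aut_group_def bij_betw_def inj_on_def)
qed

end

section \<open>The representation on tuples\<close>

definition cscale :: "complex \<Rightarrow> ('a \<Rightarrow> complex) \<Rightarrow> 'a \<Rightarrow> complex" where
  "cscale c f = (\<lambda>x. c * f x)"

global_interpretation cfun: complex_vector_space cscale
  by unfold_locales (auto simp: cscale_def fun_eq_iff algebra_simps)

definition tuples :: "nat \<Rightarrow> nat \<Rightarrow> (nat \<Rightarrow> nat) set" where
  "tuples n m = {x \<in> {1..n} \<rightarrow>\<^sub>E {0, 1}. card {i \<in> {1..n}. x i = 1} = m}"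

definition basis_vec :: "(nat \<Rightarrow> nat) \<Rightarrow> (nat \<Rightarrow> nat) \<Rightarrow> complex" where
  "basis_vec x = (\<lambda>y. if y = x then 1 else 0)"

definition Vsp :: "nat \<Rightarrow> nat \<Rightarrow> ((nat \<Rightarrow> nat) \<Rightarrow> complex) set" where
  "Vsp n m = cfun.span (basis_vec ` tuples n m)"

definition swap_at :: "nat \<Rightarrow> (nat \<Rightarrow> nat) \<Rightarrow> nat \<Rightarrow> nat" where
  "swap_at k x = x \<circ> transpose k (k + 1)"

definition qcoef :: "real \<Rightarrow> nat \<Rightarrow> nat \<Rightarrow> complex" where
  "qcoef t a b = (if a = b then 1 else complex_of_real t)"

text \<open>For \<open>f\<close> in \<open>Vsp n m\<close>, the number \<open>f x\<close> is the coefficient of \<open>f\<close> at the basis vector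
  of \<open>x\<close>; so \<open>phi_gen n m t k\<close> is the linear map on \<open>Vsp n m\<close> with the prescribed values on
  the basis, see \<open>phi_gen_basis\<close>.\<close>

definition phi_gen :: "nat \<Rightarrow> nat \<Rightarrow> real \<Rightarrow> nat \<Rightarrow>
    ((nat \<Rightarrow> nat) \<Rightarrow> complex) \<Rightarrow> (nat \<Rightarrow> nat) \<Rightarrow> complex" where
  "phi_gen n m t k = (\<lambda>f\<in>Vsp n m. \<Sum>x\<in>tuples n m.
      cscale (f x) (cscale (qcoef t (x k) (x (k + 1))) (basis_vec (swap_at k x))))"

definition phi :: "nat \<Rightarrow> nat \<Rightarrow> real \<Rightarrow> nat word set \<Rightarrow>
    ((nat \<Rightarrow> nat) \<Rightarrow> complex) \<Rightarrow> (nat \<Rightarrow> nat) \<Rightarrow> complex" where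
  "phi n m t = pres_lift (cfun.Aut_group (Vsp n m)) (phi_gen n m t)"

lemma qcoef_commute: "qcoef t a b = qcoef t b a"
  by (simp add: qcoef_def)

lemma finite_tuples: "finite (tuples n m)"
  by (rule finite_subset[of _ "{1..n} \<rightarrow>\<^sub>E {0, 1}"]) (auto simp: tuples_def intro: finite_PiE)

lemma subspace_V: "cfun.subspace (Vsp n m)"
  by (simp add: Vsp_def)

lemma sum_fun_apply: "(\<Sum>x\<in>A. g x) y = (\<Sum>x\<in>A. g x y)" for g :: "'a \<Rightarrow> 'b \<Rightarrow> complex"
  by (induction A rule: infinite_finite_induct) auto

lemma Vsp_eq: "Vsp n m = {f. \<forall>x. x \<notin> tuples n m \<longrightarrow> f x = 0}"
proof (intro equalityI subsetI)
  fix f assume "f \<in> Vsp n m"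
  then show "f \<in> {f. \<forall>x. x \<notin> tuples n m \<longrightarrow> f x = 0}"
    unfolding Vsp_def
    by (induction rule: cfun.span_induct_alt) (auto simp: basis_vec_def cscale_def split: if_splits)
next
  fix f :: "(nat \<Rightarrow> nat) \<Rightarrow> complex"
  assume f: "f \<in> {f. \<forall>x. x \<notin> tuples n m \<longrightarrow> f x = 0}"
  have "f = (\<Sum>x\<in>tuples n m. cscale (f x) (basis_vec x))"
  proof
    fix y
    have "(\<Sum>x\<in>tuples n m. cscale (f x) (basis_vec x)) y =
        (\<Sum>x\<in>tuples n m. if x = y then f x else 0)"
      unfolding sum_fun_apply by (rule sum.cong) (auto simp: cscale_def basis_vec_def)
    also have "\<dots> = f y" using f by (simp add: finite_tuples)
    finally show "f y = (\<Sum>x\<in>tuples n m. cscale (f x) (basis_vec x)) y" by simp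
  qed
  also have "\<dots> \<in> Vsp n m"
    unfolding Vsp_def by (intro cfun.span_sum cfun.span_scale cfun.span_base imageI)
  finally show "f \<in> Vsp n m" .
qed

lemma swap_at_apply [simp]:
  "swap_at k x k = x (Suc k)" "swap_at k x (Suc k) = x k"
  "i \<noteq> k \<Longrightarrow> i \<noteq> Suc k \<Longrightarrow> swap_at k x i = x i"
  by (simp_all add: swap_at_def)

lemma swap_at_swap_at [simp]: "swap_at k (swap_at k x) = x"
  by (auto simp: swap_at_def fun_eq_iff)

lemma swap_at_tuples:
  assumes k: "k \<in> {1..<n}" and x: "x \<in> tuples n m" shows "swap_at k x \<in> tuples n m"
proof -
  let ?t = "transpose k (k + 1)"
  have p: "?t i \<in> {1..n} \<longleftrightarrow> i \<in> {1..n}" for i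
    using k by (auto simp: transpose_def)
  have xP: "x \<in> {1..n} \<rightarrow>\<^sub>E {0, 1}" and xc: "card {i \<in> {1..n}. x i = 1} = m"
    using x by (simp_all add: tuples_def)
  have "bij_betw ?t {i \<in> {1..n}. swap_at k x i = 1} {i \<in> {1..n}. x i = 1}"
  proof (rule bij_betw_byWitness[where f' = ?t])
    show "?t ` {i \<in> {1..n}. swap_at k x i = 1} \<subseteq> {i \<in> {1..n}. x i = 1}"
    proof
      fix j assume "j \<in> ?t ` {i \<in> {1..n}. swap_at k x i = 1}"
      then obtain i where i: "i \<in> {1..n}" "swap_at k x i = 1" and j: "j = ?t i" by blast
      have "x j = swap_at k x i" by (simp add: swap_at_def j)
      with i show "j \<in> {i \<in> {1..n}. x i = 1}"
        unfolding j mem_Collect_eq p by simp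
    qed
    show "?t ` {i \<in> {1..n}. x i = 1} \<subseteq> {i \<in> {1..n}. swap_at k x i = 1}"
    proof
      fix j assume "j \<in> ?t ` {i \<in> {1..n}. x i = 1}"
      then obtain i where i: "i \<in> {1..n}" "x i = 1" and j: "j = ?t i" by blast
      have "swap_at k x j = x i" by (simp add: swap_at_def j)
      with i show "j \<in> {i \<in> {1..n}. swap_at k x i = 1}"
        unfolding j mem_Collect_eq p by simp
    qed
  qed simp_all
  from bij_betw_same_card[OF this] xc
  have "card {i \<in> {1..n}. swap_at k x i = 1} = m" by (rule HOL.trans)
  moreover have "swap_at k x \<in> {1..n} \<rightarrow>\<^sub>E {0, 1}"
  proof (rule PiE_I)
    fix i assume "i \<in> {1..n}"
    then show "swap_at k x i \<in> {0, 1}"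
      using PiE_mem[OF xP, of "?t i"] p[of i] by (simp add: swap_at_def)
  next
    fix i assume "i \<notin> {1..n}"
    then have "?t i \<notin> {1..n}" unfolding p .
    from PiE_arb[OF xP this] show "swap_at k x i = undefined" by (simp add: swap_at_def)
  qed
  ultimately show ?thesis by (simp add: tuples_def)
qed

lemma swap_at_tuples_iff: "k \<in> {1..<n} \<Longrightarrow> swap_at k x \<in> tuples n m \<longleftrightarrow> x \<in> tuples n m"
  using swap_at_tuples[of k n "swap_at k x" m] swap_at_tuples[of k n x m] by auto

lemma phi_gen_apply:
  assumes k: "k \<in> {1..<n}" and f: "f \<in> Vsp n m"
  shows "phi_gen n m t k f y = qcoef t (y k) (y (k + 1)) * f (swap_at k y)"
proof -
  have eq: "y = swap_at k x \<longleftrightarrow> x = swap_at k y" for x by auto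
  have "phi_gen n m t k f y = (\<Sum>x\<in>tuples n m.
      cscale (f x) (cscale (qcoef t (x k) (x (k + 1))) (basis_vec (swap_at k x))) y)"
    using f by (simp add: phi_gen_def sum_fun_apply)
  also have "\<dots> =
      (\<Sum>x\<in>tuples n m. if x = swap_at k y then f x * qcoef t (x k) (x (k + 1)) else 0)"
    unfolding cscale_def basis_vec_def eq by (rule sum.cong) simp_all
  also have "\<dots> = (if y \<in> tuples n m then f (swap_at k y) * qcoef t (y k) (y (k + 1)) else 0)"
    using swap_at_tuples_iff[OF k, of y m] by (simp add: finite_tuples qcoef_commute)
  also have "\<dots> = qcoef t (y k) (y (k + 1)) * f (swap_at k y)"
    using f swap_at_tuples_iff[OF k] by (auto simp: Vsp_eq)
  finally show ?thesis .
qed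

lemma phi_gen_V:
  assumes "k \<in> {1..<n}" "f \<in> Vsp n m" shows "phi_gen n m t k f \<in> Vsp n m"
proof -
  have "phi_gen n m t k f y = 0" if "y \<notin> tuples n m" for y
    using that assms swap_at_tuples_iff[OF assms(1)] by (simp add: phi_gen_apply) (simp add: Vsp_eq)
  then show ?thesis by (simp add: Vsp_eq)
qed

lemma phi_gen_basis:
  assumes k: "k \<in> {1..<n}" and x: "x \<in> tuples n m"
  shows "phi_gen n m t k (basis_vec x) = cscale (qcoef t (x k) (x (k + 1))) (basis_vec (swap_at k x))"
proof -
  have xV: "basis_vec x \<in> Vsp n m" unfolding Vsp_def using x by (intro cfun.span_base imageI)
  have eq: "swap_at k y = x \<longleftrightarrow> y = swap_at k x" for y by auto
  have "phi_gen n m t k (basis_vec x) y =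
      cscale (qcoef t (x k) (x (k + 1))) (basis_vec (swap_at k x)) y" for y
    unfolding phi_gen_apply[OF k xV]
    using eq[of y] by (simp add: basis_vec_def cscale_def qcoef_commute)
  then show ?thesis by blast
qed

lemma phi_gen_Aut:
  assumes k: "k \<in> {1..<n}" and t: "t \<noteq> 0"
  shows "phi_gen n m t k \<in> carrier (cfun.Aut_group (Vsp n m))"
proof -
  let ?T = "phi_gen n m t k"
  let ?S = "\<lambda>f y. f (swap_at k y) / qcoef t (y k) (y (k + 1))"
  have q0: "qcoef t a b \<noteq> 0" for a b using t by (simp add: qcoef_def)
  have SV: "?S f \<in> Vsp n m" if "f \<in> Vsp n m" for f
    using that swap_at_tuples_iff[OF k] by (auto simp: Vsp_eq)
  have "bij_betw ?T (Vsp n m) (Vsp n m)"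
  proof (rule bij_betw_byWitness[where f' = ?S])
    show "\<forall>f\<in>Vsp n m. ?S (?T f) = f"
      using k by (auto simp: fun_eq_iff phi_gen_apply qcoef_commute q0)
    show "\<forall>f\<in>Vsp n m. ?T (?S f) = f"
      using k SV by (auto simp: fun_eq_iff phi_gen_apply qcoef_commute q0)
  qed (use k SV phi_gen_V in auto)
  moreover have "?T (f + g) = ?T f + ?T g" if "f \<in> Vsp n m" "g \<in> Vsp n m" for f g
    using that k cfun.subspace_add[OF subspace_V that]
    by (auto simp: fun_eq_iff phi_gen_apply algebra_simps)
  moreover have "?T (cscale c f) = cscale c (?T f)" if "f \<in> Vsp n m" for c f
    using that k cfun.subspace_scale[OF subspace_V that, of c]
    by (auto simp: fun_eq_iff phi_gen_apply cscale_def)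
  moreover have "?T \<in> extensional (Vsp n m)" by (simp add: phi_gen_def)
  ultimately show ?thesis by (simp add: cfun.Aut_group_def)
qed

lemma phi_gen_rels:
  assumes t: "t \<noteq> 0" and uv: "(u, v) \<in> braid_rels n"
  shows "word_eval (cfun.Aut_group (Vsp n m)) (phi_gen n m t) u =
    word_eval (cfun.Aut_group (Vsp n m)) (phi_gen n m t) v"
proof -
  let ?A = "cfun.Aut_group (Vsp n m)" and ?T = "phi_gen n m t"
  interpret A: group ?A by (rule cfun.Aut_group_is_group[OF subspace_V])
  have mult: "f \<otimes>\<^bsub>?A\<^esub> g = compose (Vsp n m) f g" for f g by (simp add: cfun.Aut_group_def)
  consider (comm) k j where "k \<in> {1..<n}" "j \<in> {1..<n}" "\<bar>int k - int j\<bar> > 1"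
      "u = [(k, True), (j, True)]" "v = [(j, True), (k, True)]"
    | (braid) k where "1 \<le> k" "k + 2 \<le> n"
      "u = [(k, True), (k+1, True), (k, True)]" "v = [(k+1, True), (k, True), (k+1, True)]"
    using uv by (auto simp: braid_rels_def)
  then show ?thesis
  proof cases
    case comm
    then have d: "k \<noteq> j" "k \<noteq> Suc j" "j \<noteq> Suc k" by auto
    have "swap_at j (swap_at k y) i = swap_at k (swap_at j y) i" for y i
      using d by (cases "i = k"; cases "i = Suc k"; cases "i = j"; cases "i = Suc j") simp_all
    then have s: "swap_at j (swap_at k y) = swap_at k (swap_at j y)" for y by blast
    have "?T k (?T j f) y = ?T j (?T k f) y" if f: "f \<in> Vsp n m" for f y
      unfolding phi_gen_apply[OF comm(1) phi_gen_V[OF comm(2) f]]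
        phi_gen_apply[OF comm(2) phi_gen_V[OF comm(1) f]]
        phi_gen_apply[OF comm(1) f] phi_gen_apply[OF comm(2) f]
      using d by (simp add: s)
    then have "?T k (?T j f) = ?T j (?T k f)" if "f \<in> Vsp n m" for f
      using that by blast
    then have "compose (Vsp n m) (?T k) (?T j) = compose (Vsp n m) (?T j) (?T k)"
      by (auto simp: compose_def fun_eq_iff)
    then show ?thesis using comm phi_gen_Aut[OF _ t] by (simp add: mult[symmetric])
  next
    case braid
    have k: "k \<in> {1..<n}" "k + 1 \<in> {1..<n}" using braid by auto
    have "swap_at k (swap_at (Suc k) (swap_at k y)) i =
        swap_at (Suc k) (swap_at k (swap_at (Suc k) y)) i" for y i
      by (cases "i = k"; cases "i = Suc k"; cases "i = Suc (Suc k)") simp_all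
    then have s: "swap_at k (swap_at (Suc k) (swap_at k y)) =
        swap_at (Suc k) (swap_at k (swap_at (Suc k) y))" for y by blast
    have "?T k (?T (k+1) (?T k f)) y = ?T (k+1) (?T k (?T (k+1) f)) y"
      if f: "f \<in> Vsp n m" for f y
      unfolding phi_gen_apply[OF k(1) phi_gen_V[OF k(2) phi_gen_V[OF k(1) f]]]
        phi_gen_apply[OF k(2) phi_gen_V[OF k(1) phi_gen_V[OF k(2) f]]]
        phi_gen_apply[OF k(1) phi_gen_V[OF k(2) f]]
        phi_gen_apply[OF k(2) phi_gen_V[OF k(1) f]]
        phi_gen_apply[OF k(1) f] phi_gen_apply[OF k(2) f]
      by (simp add: s)
    then have "?T k (?T (k+1) (?T k f)) = ?T (k+1) (?T k (?T (k+1) f))"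
      if "f \<in> Vsp n m" for f using that by blast
    then have "compose (Vsp n m) (?T k) (compose (Vsp n m) (?T (k+1)) (?T k)) =
        compose (Vsp n m) (?T (k+1)) (compose (Vsp n m) (?T k) (?T (k+1)))"
      by (auto simp: compose_def fun_eq_iff)
    then show ?thesis using braid k phi_gen_Aut[OF _ t] by (simp add: mult[symmetric])
  qed
qed

lemma phi_hom:
  assumes t: "t \<noteq> 0" shows "phi n m t \<in> hom (braid_group n) (cfun.Aut_group (Vsp n m))"
  unfolding phi_def braid_group_def
  by (rule pres_lift_hom[OF cfun.Aut_group_is_group[OF subspace_V]])
    (rule phi_gen_Aut[OF _ t] phi_gen_rels[OF t], assumption)+

lemma phi_braid_gen:
  assumes t: "t \<noteq> 0" and k: "k \<in> {1..<n}"
  shows "phi n m t (braid_gen n k) = phi_gen n m t k"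
  unfolding phi_def braid_gen_def
  by (rule pres_lift_gen[OF cfun.Aut_group_is_group[OF subspace_V] _ _ k])
    (rule phi_gen_Aut[OF _ t] phi_gen_rels[OF t], assumption)+

end

theory Submission
  imports Defs
begin

text \<open>The square of \<open>\<phi> \<tau>\<^sub>k\<close> is diagonal, with eigenvalue \<open>t\<^sup>2 \<noteq> 1\<close> on the basis vectors with
  \<open>x\<^sub>k \<noteq> x\<^sub>k\<^sub>+\<^sub>1\<close> and \<open>1\<close> on the others, so an invariant subspace is closed under the projection
  to either kind. The set of all \<open>k\<close> with \<open>x\<^sub>k \<noteq> x\<^sub>k\<^sub>+\<^sub>1\<close> determines \<open>x\<close> up to complement, and the
  complement of \<open>x\<close> is excluded by \<open>2m \<noteq> n\<close>; hence a nonzero invariant subspace contains a basis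
  vector, and then all of them, since adjacent swaps act transitively on the tuples. For the corank,
  \<open>\<phi> \<tau>\<^sub>k - 1\<close> vanishes on the basis vectors with \<open>x\<^sub>k = x\<^sub>k\<^sub>+\<^sub>1\<close>, and on each pair exchanged
  by the swap it has determinant \<open>1 - t\<^sup>2 \<noteq> 0\<close>.\<close>

section \<open>Coordinate subspaces and their dimension\<close>

text \<open>A function supported in \<open>S\<close> is the finite sum of its values times basis
  vectors. The general \<open>S\<close> serves both the independence proof, with one tuple removed,
  and the image that gives the corank.\<close>

lemma span_basis_vec:
  assumes "finite S"
  shows "cfun.span (basis_vec ` S) = {f. \<forall>x. x \<notin> S \<longrightarrow> f x = 0}"
proof (intro equalityI subsetI)
  fix f assume "f \<in> cfun.span (basis_vec ` S)"
  then show "f \<in> {f. \<forall>x. x \<notin> S \<longrightarrow> f x = 0}"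
    by (induction rule: cfun.span_induct_alt) (auto simp: basis_vec_def cscale_def split: if_splits)
next
  fix f :: "(nat \<Rightarrow> nat) \<Rightarrow> complex"
  assume f: "f \<in> {f. \<forall>x. x \<notin> S \<longrightarrow> f x = 0}"
  have "f y = (\<Sum>x\<in>S. cscale (f x) (basis_vec x)) y" for y
  proof -
    have "(\<Sum>x\<in>S. cscale (f x) (basis_vec x)) y = (\<Sum>x\<in>S. if x = y then f x else 0)"
      unfolding sum_fun_apply by (rule sum.cong) (auto simp: cscale_def basis_vec_def)
    then show ?thesis using f assms by simp
  qed
  then have "f = (\<Sum>x\<in>S. cscale (f x) (basis_vec x))" by blast
  also have "\<dots> \<in> cfun.span (basis_vec ` S)"
    by (intro cfun.span_sum cfun.span_scale cfun.span_base imageI)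
  finally show "f \<in> cfun.span (basis_vec ` S)" .
qed

lemma basis_vec_same [simp]: "basis_vec x x = 1"
  and basis_vec_other: "y \<noteq> x \<Longrightarrow> basis_vec x y = 0"
  by (simp_all add: basis_vec_def)

lemma inj_basis_vec: "inj basis_vec"
proof (rule injI)
  fix x y assume "basis_vec x = basis_vec y"
  then have "basis_vec y x = 1" by (metis basis_vec_same)
  then show "x = y" by (auto simp: basis_vec_def split: if_splits)
qed

lemma dim_span_basis_vec:
  assumes "finite S" shows "cfun.dim (cfun.span (basis_vec ` S)) = card S"
proof -
  have "cfun.independent (basis_vec ` S)"
    unfolding cfun.dependent_def
  proof
    assume "\<exists>a\<in>basis_vec ` S. a \<in> cfun.span (basis_vec ` S - {a})"
    then obtain x where "basis_vec x \<in> cfun.span (basis_vec ` S - {basis_vec x})" by blast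
    moreover have "basis_vec ` S - {basis_vec x} = basis_vec ` (S - {x})"
      using inj_basis_vec by (auto simp: inj_eq)
    ultimately have "basis_vec x \<in> {f. \<forall>y. y \<notin> S - {x} \<longrightarrow> f y = 0}"
      using assms span_basis_vec[of "S - {x}"] by simp
    \<comment> \<open>Membership in the span of the other basis vectors forces the value at
      \<open>x\<close> to vanish.\<close>
    then have "basis_vec x x = 0" by blast
    then show False by simp
  qed
  then have "cfun.dim (cfun.span (basis_vec ` S)) = card (basis_vec ` S)"
    by (rule cfun.dim_span_eq_card_independent)
  then show ?thesis
    by (simp add: card_image inj_on_subset[OF inj_basis_vec])
qed

section \<open>Counting tuples\<close>

lemma tuples_range: "x \<in> tuples n m \<Longrightarrow> i \<in> {1..n} \<Longrightarrow> x i = 0 \<or> x i = 1"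
  using PiE_mem[of x "{1..n}" "\<lambda>_. {0, 1}" i] by (simp add: tuples_def)

lemma tuples_eqI:
  assumes "x \<in> tuples n m" "y \<in> tuples n m" "\<And>i. i \<in> {1..n} \<Longrightarrow> x i = y i"
  shows "x = y"
  by (rule PiE_ext[of x "{1..n}" "\<lambda>_. {0, 1}"]) (use assms in \<open>simp_all add: tuples_def\<close>)

definition ones :: "nat \<Rightarrow> (nat \<Rightarrow> nat) \<Rightarrow> nat set" where
  "ones n x = {i \<in> {1..n}. x i = 1}"

text \<open>The inverse is the indicator function, restricted to \<open>{1..n}\<close> because
  tuples are \<open>undefined\<close> elsewhere. Counting tuples thus becomes counting
  subsets.\<close>

lemma ones_bij:
  "bij_betw (ones n) (tuples n m) {A. A \<subseteq> {1..n} \<and> card A = m}"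
proof (rule bij_betw_byWitness[where f' = "\<lambda>A. \<lambda>i\<in>{1..n}. if i \<in> A then 1 else 0"])
  let ?g = "\<lambda>A. \<lambda>i\<in>{1..n}. if i \<in> A then 1 else 0 :: nat"
  have ones_g: "ones n (?g A) = A" if "A \<subseteq> {1..n}" for A
    using that by (auto simp: ones_def)
  then show "\<forall>A\<in>{A. A \<subseteq> {1..n} \<and> card A = m}. ones n (?g A) = A"
    by blast
  show "\<forall>x\<in>tuples n m. ?g (ones n x) = x"
  proof
    fix x assume x: "x \<in> tuples n m"
    have "?g (ones n x) i = x i" for i
      using x tuples_range[OF x, of i]
      by (cases "i \<in> {1..n}") (auto simp: ones_def tuples_def PiE_def extensional_def)
    then show "?g (ones n x) = x" by blast
  qed
  show "ones n ` tuples n m \<subseteq> {A. A \<subseteq> {1..n} \<and> card A = m}"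
    by (auto simp: ones_def tuples_def)
  have "?g A \<in> tuples n m" if "A \<subseteq> {1..n}" "card A = m" for A
  proof -
    have "card {i \<in> {1..n}. ?g A i = 1} = m" using ones_g[of A] that by (simp add: ones_def)
    then show ?thesis unfolding tuples_def by auto
  qed
  then show "?g ` {A. A \<subseteq> {1..n} \<and> card A = m} \<subseteq> tuples n m" by blast
qed

lemma card_tuples: "card (tuples n m) = n choose m"
  using bij_betw_same_card[OF ones_bij, of n m] n_subsets[of "{1..n}" m] by simp

text \<open>Exactly one of \<open>k\<close> and \<open>k + 1\<close> carries a one, which leaves
  \<open>m - 1\<close> ones to be placed freely on the other \<open>n - 2\<close> positions; the
  members of \<open>F\<close> are these placements.\<close>

lemma card_tuples_unequal:
  assumes k: "k \<in> {1..<n}" and m: "1 \<le> m"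
  shows "card {x \<in> tuples n m. x k \<noteq> x (k + 1)} = 2 * ((n - 2) choose (m - 1))"
proof -
  define F where "F = {B. B \<subseteq> {1..n} - {k, k + 1} \<and> card B = m - 1}"
  have kn: "{k, k + 1} \<subseteq> {1..n}" using k by auto
  have finF: "finite F" unfolding F_def by (rule finite_subset[of _ "Pow {1..n}"]) auto
  have "card ({1..n} - {k, k + 1}) = n - 2"
    by (subst card_Diff_subset[OF _ kn]) simp_all
  then have cardF: "card F = (n - 2) choose (m - 1)"
    unfolding F_def by (subst n_subsets) simp_all
  have finB: "finite B" if "B \<in> F" for B
    by (rule finite_subset[of _ "{1..n}"]) (use that in \<open>auto simp: F_def\<close>)
  have notin: "k \<notin> B" "k + 1 \<notin> B" if "B \<in> F" for B using that by (auto simp: F_def)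
  have inj: "inj_on (insert k) F" "inj_on (insert (k + 1)) F"
    using notin by (auto intro!: inj_onI simp: insert_ident)
  have bij: "bij_betw (ones n) {x \<in> tuples n m. x k \<noteq> x (k + 1)}
      (insert k ` F \<union> insert (k + 1) ` F)"
  proof (rule bij_betw_subset[OF ones_bij])
    let ?P = "\<lambda>A. (k \<in> A) \<noteq> (k + 1 \<in> A)"
    have "x k \<noteq> x (k + 1) \<longleftrightarrow> ?P (ones n x)" if "x \<in> tuples n m" for x
      using tuples_range[OF that, of k] tuples_range[OF that, of "k + 1"] kn
      by (auto simp: ones_def)
    then have "ones n ` {x \<in> tuples n m. x k \<noteq> x (k + 1)} = {A \<in> ones n ` tuples n m. ?P A}"
      by blast
    also have "\<dots> = {A. A \<subseteq> {1..n} \<and> card A = m \<and> ?P A}"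
      using ones_bij[of n m] by (auto simp: bij_betw_def)
    also have "\<dots> = insert k ` F \<union> insert (k + 1) ` F"
    proof (intro equalityI subsetI)
      fix A assume A: "A \<in> {A. A \<subseteq> {1..n} \<and> card A = m \<and> ?P A}"
      then have fin: "finite A" using finite_subset[of A "{1..n}"] by simp
      from A consider "k \<in> A" "k + 1 \<notin> A" | "k + 1 \<in> A" "k \<notin> A" by blast
      then show "A \<in> insert k ` F \<union> insert (k + 1) ` F"
      proof cases
        case 1
        then have "A - {k} \<in> F" using A fin by (auto simp: F_def)
        moreover have "A = insert k (A - {k})" using 1 by blast
        ultimately show ?thesis by blast
      next
        case 2
        then have "A - {k + 1} \<in> F" using A fin by (auto simp: F_def)
        moreover have "A = insert (k + 1) (A - {k + 1})" using 2 by blast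
        ultimately show ?thesis by blast
      qed
    next
      fix A assume "A \<in> insert k ` F \<union> insert (k + 1) ` F"
      then obtain B where B: "B \<in> F" "A = insert k B \<or> A = insert (k + 1) B" by blast
      have "card A = m" using B(2) finB[OF B(1)] notin[OF B(1)] B(1) m by (auto simp: F_def)
      moreover have "A \<subseteq> {1..n}" using B kn by (auto simp: F_def)
      moreover have "?P A" using B(2) notin[OF B(1)] by auto
      ultimately show "A \<in> {A. A \<subseteq> {1..n} \<and> card A = m \<and> ?P A}" by simp
    qed
    finally show "ones n ` {x \<in> tuples n m. x k \<noteq> x (k + 1)} =
        insert k ` F \<union> insert (k + 1) ` F" .
  qed blast
  have "insert k ` F \<inter> insert (k + 1) ` F = {}" 
  proof (intro equals0I, elim IntE imageE)
    fix A B B' assume "A = insert k B" "A = insert (k + 1) B'" "B \<in> F" "B' \<in> F"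
    then have "k \<in> insert (k + 1) B'" by blast
    then show False using notin(1)[OF \<open>B' \<in> F\<close>] by simp
  qed
  then have "card (insert k ` F \<union> insert (k + 1) ` F) = card F + card F"
    using finF inj by (simp add: card_Un_disjoint card_image)
  then show ?thesis using bij_betw_same_card[OF bij] cardF by simp
qed

section \<open>Transitivity of adjacent swaps\<close>

text \<open>A tuple of minimal weight \<open>\<Sum>i. i * x i\<close> in a set closed under adjacent swaps has all its
  ones in front.\<close>

lemma swap_closed_contains_sorted:
  assumes C: "C \<subseteq> tuples n m" "C \<noteq> {}"
    and closed: "\<And>x k. x \<in> C \<Longrightarrow> k \<in> {1..<n} \<Longrightarrow> swap_at k x \<in> C"
  shows "(\<lambda>i\<in>{1..n}. if i \<le> m then 1 else 0) \<in> C"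
proof -
  define wt :: "(nat \<Rightarrow> nat) \<Rightarrow> nat" where "wt x = (\<Sum>i\<in>{1..n}. i * x i)" for x
  obtain x where x: "x \<in> C" and min: "\<And>y. y \<in> C \<Longrightarrow> wt x \<le> wt y"
    using ex_has_least_nat[of "\<lambda>x. x \<in> C" _ wt] C(2) by blast
  have xT: "x \<in> tuples n m" using x C by blast
  \<comment> \<open>A one directly after a zero could be swapped forward, which lowers
    \<open>wt\<close> by exactly 1 and contradicts minimality.\<close>
  have step: "x (Suc k) = 1 \<Longrightarrow> x k = 1" if k: "k \<in> {1..<n}" for k
  proof (rule ccontr)
    assume 1: "x (Suc k) = 1" and "x k \<noteq> 1"
    then have 0: "x k = 0" using tuples_range[OF xT, of k] k by auto
    let ?y = "swap_at k x"
    have split: "{1..n} = insert k (insert (Suc k) ({1..n} - {k, Suc k}))" using k by auto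
    have wt_split: "wt z = k * z k + Suc k * z (Suc k) + (\<Sum>i\<in>{1..n} - {k, Suc k}. i * z i)" for z
      unfolding wt_def by (subst split) simp
    have "(\<Sum>i\<in>{1..n} - {k, Suc k}. i * ?y i) = (\<Sum>i\<in>{1..n} - {k, Suc k}. i * x i)"
      by (rule sum.cong) auto
    then have "wt ?y < wt x" by (simp add: wt_split 0 1)
    with min[OF closed[OF x k]] show False by simp
  qed
  have down: "x j = 1" if "x i = 1" "1 \<le> j" "j \<le> i" "i \<le> n" for i j
    using \<open>j \<le> i\<close> \<open>x i = 1\<close> \<open>1 \<le> j\<close> \<open>i \<le> n\<close>
    by (induction rule: inc_induct) (use step in auto)
  have m: "card {i \<in> {1..n}. x i = 1} = m" using xT by (simp add: tuples_def)
  have "(\<lambda>i\<in>{1..n}. if i \<le> m then 1 else 0) i = x i" for i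
  proof (cases "i \<in> {1..n}")
    case True
    show ?thesis
    proof (cases "x i = 1")
      case 1: True
      \<comment> \<open>The ones form an initial segment, so comparing it with \<open>{1..i}\<close>
        or \<open>{1..<i}\<close> decides whether \<open>i\<close> is at most
        \<open>m\<close>.\<close>
      then have "{1..i} \<subseteq> {i \<in> {1..n}. x i = 1}" using True down[of i] by auto
      from card_mono[OF _ this] have "i \<le> m" using m by simp
      then show ?thesis using True 1 by simp
    next
      case 2: False
      have "j < i" if "j \<in> {1..n}" "x j = 1" for j
        using down[of j i] that 2 True by (cases "j < i") auto
      then have "{i \<in> {1..n}. x i = 1} \<subseteq> {1..<i}" by auto
      from card_mono[OF _ this] have "m \<le> i - 1" using m by simp
      then have "m < i" using True by auto
      then show ?thesis using True 2 tuples_range[OF xT True] by simp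
    qed
  next
    case False
    then show ?thesis using xT by (auto simp: tuples_def PiE_def extensional_def)
  qed
  then have "(\<lambda>i\<in>{1..n}. if i \<le> m then 1 else 0) = x" by blast
  with x show ?thesis by simp
qed

text \<open>Swaps are involutions, so the complement of \<open>C\<close> is swap-closed too; if it
  were nonempty, it would share the sorted tuple with \<open>C\<close>.\<close>

lemma swap_closed_eq_tuples:
  assumes C: "C \<subseteq> tuples n m" "C \<noteq> {}"
    and closed: "\<And>x k. x \<in> C \<Longrightarrow> k \<in> {1..<n} \<Longrightarrow> swap_at k x \<in> C"
  shows "C = tuples n m"
proof (rule ccontr)
  assume "C \<noteq> tuples n m"
  then have "tuples n m - C \<noteq> {}" using C by blast
  moreover have "swap_at k x \<in> tuples n m - C" if "x \<in> tuples n m - C" "k \<in> {1..<n}" for x k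
    using that closed[of "swap_at k x" k] swap_at_tuples[of k n x m] by auto
  ultimately have "(\<lambda>i\<in>{1..n}. if i \<le> m then 1 else 0) \<in> tuples n m - C"
    by (intro swap_closed_contains_sorted) auto
  with swap_closed_contains_sorted[OF assms] show False by blast
qed

section \<open>Recovering a tuple from its changes\<close>

lemma tuples_eq_if_same_changes:
  assumes x: "x \<in> tuples n m" and y: "y \<in> tuples n m" and mn: "2 * m \<noteq> n"
    and same: "\<And>k. k \<in> {1..<n} \<Longrightarrow> x k = x (k + 1) \<longleftrightarrow> y k = y (k + 1)"
  shows "x = y"
proof -
  \<comment> \<open>Entries are 0 or 1, so equal change patterns carry agreement or disagreement at
    position 1 along to every \<open>i\<close>.\<close>
  have const: "x i = y i \<longleftrightarrow> x 1 = y 1" if "1 \<le> i" "i \<le> n" for i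
    using that
  proof (induction i rule: dec_induct)
    case (step i)
    have "x i = 0 \<or> x i = 1" "y i = 0 \<or> y i = 1" "x (i + 1) = 0 \<or> x (i + 1) = 1"
      "y (i + 1) = 0 \<or> y (i + 1) = 1"
      using step tuples_range[OF x] tuples_range[OF y] by auto
    then show ?case using same[of i] step by auto
  qed simp
  show ?thesis
  proof (cases "x 1 = y 1")
    case True
    then show ?thesis using const by (intro tuples_eqI[OF x y]) auto
  next
    case False
    \<comment> \<open>Here \<open>y\<close> is the complement of \<open>x\<close> and has
      \<open>n - m\<close> ones, which is not \<open>m\<close>.\<close>
    have "y i = 1 \<longleftrightarrow> x i \<noteq> 1" if "i \<in> {1..n}" for i
      using const[of i] False that tuples_range[OF x that] tuples_range[OF y that] by auto
    then have "{i \<in> {1..n}. y i = 1} = {1..n} - {i \<in> {1..n}. x i = 1}" by auto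
    also have "card \<dots> = card {1..n} - card {i \<in> {1..n}. x i = 1}"
      by (rule card_Diff_subset) auto
    finally have "card {i \<in> {1..n}. y i = 1} = n - card {i \<in> {1..n}. x i = 1}"
      by simp
    moreover have "card {i \<in> {1..n}. x i = 1} \<le> n"
      by (rule order_trans[OF card_mono[of "{1..n}"]]) auto
    moreover have "card {i \<in> {1..n}. x i = 1} = m" "card {i \<in> {1..n}. y i = 1} = m"
      using x y by (simp_all add: tuples_def)
    ultimately show ?thesis using mn by linarith
  qed
qed

section \<open>Invariant subspaces\<close>

lemma cscale_apply [simp]: "cscale c f x = c * f x"
  by (simp add: cscale_def)

lemma square_neq_1:
  fixes t :: real assumes "t \<noteq> 1" "t \<noteq> -1"
  shows "complex_of_real t * complex_of_real t \<noteq> 1"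
proof
  assume "complex_of_real t * complex_of_real t = 1"
  then have "complex_of_real (t * t) = complex_of_real 1" by simp
  then have "t * t = 1" unfolding of_real_eq_iff .
  then show False using assms by (simp add: square_eq_1_iff)
qed

context
  fixes n m :: nat and t :: real and W :: "((nat \<Rightarrow> nat) \<Rightarrow> complex) set"
  assumes W: "cfun.subspace W" "W \<subseteq> Vsp n m"
    and inv: "\<And>k f. k \<in> {1..<n} \<Longrightarrow> f \<in> W \<Longrightarrow> phi_gen n m t k f \<in> W"
    and t: "t \<noteq> 0" "t \<noteq> 1" "t \<noteq> -1"
begin

lemma invariant_proj_unequal:
  assumes k: "k \<in> {1..<n}" and f: "f \<in> W"
  shows "(\<lambda>y. if y k \<noteq> y (k + 1) then f y else 0) \<in> W"
proof -
  let ?T = "phi_gen n m t k" and ?c = "complex_of_real t * complex_of_real t - 1"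
  have c: "?c \<noteq> 0" using square_neq_1[OF t(2,3)] by simp
  have fV: "f \<in> Vsp n m" using f W by blast
  \<comment> \<open>\<open>?T\<close> squared multiplies by the square of \<open>t\<close> where the
    two entries differ and by 1 elsewhere; subtracting the identity and dividing by
    \<open>?c\<close> leaves the projection.\<close>
  have "(\<lambda>y. if y k \<noteq> y (k + 1) then f y else 0) = cscale (1 / ?c) (?T (?T f) - f)"
  proof
    fix y
    have "?T (?T f) y =
        qcoef t (y k) (y (k + 1)) * (qcoef t (y (k + 1)) (y k) * f y)"
      by (simp add: phi_gen_apply[OF k phi_gen_V[OF k fV]] phi_gen_apply[OF k fV])
    then have "(?T (?T f) - f) y = (if y k \<noteq> y (k + 1) then ?c * f y else 0)"
      by (simp add: qcoef_def left_diff_distrib)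
    then show "(if y k \<noteq> y (k + 1) then f y else 0) = cscale (1 / ?c) (?T (?T f) - f) y"
      unfolding cscale_apply using c by (simp del: minus_apply)
  qed
  also have "\<dots> \<in> W"
    by (intro cfun.subspace_scale cfun.subspace_diff W inv k f)
  finally show ?thesis .
qed

text \<open>For each \<open>k\<close> in turn, apply the projection onto the unequal kind if
  \<open>x\<close> changes at \<open>k\<close>, and its complement \<open>g - ?h\<close>
  otherwise.\<close>

lemma invariant_proj_pattern:
  assumes "finite K" "K \<subseteq> {1..<n}" "f \<in> W"
  shows "(\<lambda>y. if \<forall>k\<in>K. x k = x (k + 1) \<longleftrightarrow> y k = y (k + 1) then f y else 0) \<in> W"
  using assms(1,2)
proof (induction K)
  case empty
  then show ?case using assms(3) by simp
next
  case (insert k K)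
  define g where "g = (\<lambda>y. if \<forall>k\<in>K. x k = x (k + 1) \<longleftrightarrow> y k = y (k + 1) then f y else 0)"
  let ?h = "\<lambda>y. if y k \<noteq> y (k + 1) then g y else 0"
  let ?G = "\<lambda>y. if \<forall>k\<in>insert k K. x k = x (k + 1) \<longleftrightarrow> y k = y (k + 1) then f y else 0"
  have g: "g \<in> W" using insert by (simp add: g_def)
  then have h: "?h \<in> W" using invariant_proj_unequal[of k g] insert by simp
  show ?case
  proof (cases "x k = x (k + 1)")
    case True
    then have "?G = g - ?h" by (auto simp: g_def fun_eq_iff)
    also have "\<dots> \<in> W" by (intro cfun.subspace_diff W g h)
    finally show ?thesis .
  next
    case False
    then have "?G = ?h" by (auto simp: g_def fun_eq_iff)
    with h show ?thesis by simp
  qed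
qed

text \<open>Prescribing the changes of \<open>x\<close> at all positions at once leaves only the
  component of \<open>f\<close> at \<open>x\<close>, which is then rescaled.\<close>

lemma invariant_basis_vec:
  assumes mn: "2 * m \<noteq> n" and f: "f \<in> W" and x: "f x \<noteq> 0"
  shows "basis_vec x \<in> W"
proof -
  have fV: "\<And>y. y \<notin> tuples n m \<Longrightarrow> f y = 0" using f W by (auto simp: Vsp_eq)
  then have xT: "x \<in> tuples n m" using x by blast
  let ?g = "\<lambda>y. if \<forall>k\<in>{1..<n}. x k = x (k + 1) \<longleftrightarrow> y k = y (k + 1) then f y else 0"
  have "basis_vec x y = cscale (1 / f x) ?g y" for y
  proof (cases "y = x")
    case True
    then show ?thesis using x by simp
  next
    case False
    then have "\<not> (\<forall>k\<in>{1..<n}. x k = x (k + 1) \<longleftrightarrow> y k = y (k + 1)) \<or> f y = 0"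
      using fV[of y] tuples_eq_if_same_changes[OF xT _ mn, of y] by blast
    then have "?g y = 0" by (rule disjE) (simp_all only: if_False if_cancel)
    then show ?thesis using False by (simp add: basis_vec_other)
  qed
  then have "basis_vec x = cscale (1 / f x) ?g" by blast
  also have "\<dots> \<in> W" by (intro cfun.subspace_scale W invariant_proj_pattern f) auto
  finally show ?thesis .
qed

lemma invariant_subspace_trivial:
  assumes mn: "2 * m \<noteq> n" shows "W = {0} \<or> W = Vsp n m"
proof (cases "W \<subseteq> {0}")
  case True
  then show ?thesis using cfun.subspace_0[OF W(1)] by blast
next
  case False
  then obtain f where f: "f \<in> W" "f \<noteq> 0" by blast
  then obtain x where x: "f x \<noteq> 0" by (auto simp: fun_eq_iff)
  define C where "C = {x \<in> tuples n m. basis_vec x \<in> W}"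
  have "x \<in> tuples n m" using x f W by (auto simp: Vsp_eq)
  then have "C \<noteq> {}" using invariant_basis_vec[OF mn f(1) x] by (auto simp: C_def)
  moreover have "swap_at k y \<in> C" if y: "y \<in> C" and k: "k \<in> {1..<n}" for y k
  proof -
    have yT: "y \<in> tuples n m" and yW: "basis_vec y \<in> W" using y by (auto simp: C_def)
    \<comment> \<open>Only a nonzero coefficient at the swapped tuple is needed:
      \<open>invariant_basis_vec\<close> then extracts the basis vector, with no division by 1 or
      \<open>t\<close>.\<close>
    have "phi_gen n m t k (basis_vec y) (swap_at k y) \<noteq> 0"
      using phi_gen_basis[OF k yT, of t] t(1) by (simp add: qcoef_def)
    then have "basis_vec (swap_at k y) \<in> W"
      using invariant_basis_vec[OF mn inv[OF k yW]] by blast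
    then show ?thesis using swap_at_tuples[OF k yT] by (simp add: C_def)
  qed
  ultimately have "C = tuples n m"
    by (intro swap_closed_eq_tuples) (auto simp: C_def)
  then have "basis_vec ` tuples n m \<subseteq> W" by (auto simp: C_def)
  then have "Vsp n m \<subseteq> W" unfolding Vsp_def using W(1) by (rule cfun.span_minimal)
  with W show ?thesis by blast
qed

end

lemma braid_gen_carrier:
  assumes "k \<in> {1..<n}" shows "braid_gen n k \<in> carrier (braid_group n)"
  using assms by (auto simp: braid_gen_def pres_gen_def braid_group_def presented_group_def)

section \<open>The image of a generator minus the identity\<close>

text \<open>Where the entries at \<open>k\<close> and \<open>k + 1\<close> agree, the swap fixes the
  tuple and the coefficient is 1, so the difference vanishes; on the remaining tuples every value is
  attained, by an explicit preimage.\<close>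

lemma phi_gen_diff_image:
  assumes k: "k \<in> {1..<n}" and t: "t \<noteq> 1" "t \<noteq> -1"
  shows "(\<lambda>f. phi_gen n m t k f - f) ` Vsp n m =
    cfun.span (basis_vec ` {x \<in> tuples n m. x k \<noteq> x (k + 1)})" (is "?L = cfun.span (_ ` ?S)")
proof -
  have swap_eq: "swap_at k y = y" if "y k = y (k + 1)" for y
  proof
    fix i show "swap_at k y i = y i"
      using that by (cases "i = k"; cases "i = Suc k") auto
  qed
  have span: "cfun.span (basis_vec ` ?S) = {f. \<forall>x. x \<notin> ?S \<longrightarrow> f x = 0}"
    by (rule span_basis_vec) (simp add: finite_tuples)
  show ?thesis unfolding span
  proof (intro equalityI subsetI)
    fix g assume "g \<in> ?L"
    then obtain f where f: "f \<in> Vsp n m" "g = phi_gen n m t k f - f" by blast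
    have "g y = 0" if "y \<notin> ?S" for y
    proof (cases "y \<in> tuples n m")
      case True
      then show ?thesis using that swap_eq[of y] f(2) by (simp add: phi_gen_apply[OF k f(1)] qcoef_def)
    next
      case False
      then show ?thesis using f phi_gen_V[OF k f(1), of t] by (simp add: Vsp_eq)
    qed
    then show "g \<in> {f. \<forall>x. x \<notin> ?S \<longrightarrow> f x = 0}" by blast
  next
    fix g :: "(nat \<Rightarrow> nat) \<Rightarrow> complex"
    assume g: "g \<in> {f. \<forall>x. x \<notin> ?S \<longrightarrow> f x = 0}"
    let ?t = "complex_of_real t"
    have c: "?t * ?t - 1 \<noteq> 0" using square_neq_1[OF t] by simp
    \<comment> \<open>The inverse of the block \<open>f \<mapsto> t f(sy) - f(y)\<close>, found by solving the 2-by-2 system.\<close>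
    define f where "f y = (g y + ?t * g (swap_at k y)) / (?t * ?t - 1)" for y
    have g0: "g y = 0" if "y \<notin> tuples n m \<or> y k = y (k + 1)" for y using g that by auto
    have fV: "f \<in> Vsp n m"
      using g0 swap_at_tuples_iff[OF k] by (auto simp: Vsp_eq f_def)
    have "g y = (phi_gen n m t k f - f) y" for y
    proof (cases "y k = y (k + 1)")
      case True
      then show ?thesis using g0[of y] swap_eq[of y]
        by (simp add: phi_gen_apply[OF k fV] qcoef_def)
    next
      case False
      then have "(phi_gen n m t k f - f) y = ?t * f (swap_at k y) - f y"
        by (simp add: phi_gen_apply[OF k fV] qcoef_def)
      \<comment> \<open>The swap is an involution, so the terms \<open>?t * g (swap_at k y)\<close>
        cancel in the numerator.\<close>
      also have "\<dots> = (?t * ?t - 1) * g y / (?t * ?t - 1)"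
        by (simp add: f_def algebra_simps flip: diff_divide_distrib add_divide_distrib)
      finally show ?thesis using c by simp
    qed
    then have "g = phi_gen n m t k f - f" by blast
    then show "g \<in> ?L" using fV by blast
  qed
qed

theorem theorem2p4:
  fixes n m :: nat and t :: real
  assumes "n > 2" and "1 \<le> m" and "m < n" and "2 * m \<noteq> n"
    and "t \<noteq> 0" and "t \<noteq> 1" and "t \<noteq> -1"
  shows "cfun.irreducible_braid_rep n (Vsp n m) (phi n m t) \<and>
    cfun.dim (Vsp n m) = n choose m \<and>
    (\<forall>k\<in>{1..<n}. real (cfun.corank n (Vsp n m) (phi n m t) k) =
      2 * fact (n - 2) / (fact (m - 1) * fact (n - m - 1)))"
proof (intro conjI ballI)
  have "\<exists>B. finite B \<and> Vsp n m = cfun.span B"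
    unfolding Vsp_def using finite_tuples by blast
  then have rep: "cfun.braid_rep n (Vsp n m) (phi n m t)"
    using subspace_V phi_hom[OF \<open>t \<noteq> 0\<close>] by (simp add: cfun.braid_rep_def)
  show dim: "cfun.dim (Vsp n m) = n choose m"
    unfolding Vsp_def dim_span_basis_vec[OF finite_tuples] by (rule card_tuples)
  \<comment> \<open>Since \<open>m < n\<close>, the binomial coefficient is positive, so there is a
    tuple and the space is nonzero.\<close>
  have "card (tuples n m) \<noteq> 0" using assms by (simp add: card_tuples)
  then obtain x where x: "x \<in> tuples n m" by (metis card.empty ex_in_conv)
  have "basis_vec x \<in> Vsp n m" unfolding Vsp_def using x by (intro cfun.span_base imageI)
  moreover have "basis_vec x \<noteq> 0" by (metis basis_vec_same zero_fun_apply zero_neq_one)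
  ultimately have nonzero: "Vsp n m \<noteq> {0}" by blast
  have "W = {0} \<or> W = Vsp n m"
    if W: "cfun.subspace W" "W \<subseteq> Vsp n m"
      and inv: "\<forall>g\<in>carrier (braid_group n). phi n m t g ` W \<subseteq> W" for W
  proof (rule invariant_subspace_trivial[OF W _ assms(5-7,4)])
    fix k f assume k: "k \<in> {1..<n}" and f: "f \<in> W"
    show "phi_gen n m t k f \<in> W"
      using inv braid_gen_carrier[OF k] f phi_braid_gen[OF \<open>t \<noteq> 0\<close> k, of m] by fastforce
  qed
  with rep nonzero show "cfun.irreducible_braid_rep n (Vsp n m) (phi n m t)"
    by (simp add: cfun.irreducible_braid_rep_def)
  fix k assume k: "k \<in> {1..<n}"
  have fin: "finite {x \<in> tuples n m. x k \<noteq> x (k + 1)}" by (simp add: finite_tuples)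
  have "cfun.corank n (Vsp n m) (phi n m t) k = 2 * ((n - 2) choose (m - 1))"
    unfolding cfun.corank_def phi_braid_gen[OF \<open>t \<noteq> 0\<close> k] phi_gen_diff_image[OF k assms(6,7)]
      dim_span_basis_vec[OF fin] by (rule card_tuples_unequal[OF k assms(2)])
  \<comment> \<open>The truncated subtractions are harmless: \<open>1 \<le> m\<close> and
    \<open>m < n\<close> give \<open>m - 1 \<le> n - 2\<close> and
    \<open>(n - 2) - (m - 1) = n - m - 1\<close>.\<close>
  moreover have "real ((n - 2) choose (m - 1)) =
      fact (n - 2) / (fact (m - 1) * fact (n - m - 1))"
    using binomial_fact[of "m - 1" "n - 2", where ?'a = real] assms(2,3) by simp
  ultimately show "real (cfun.corank n (Vsp n m) (phi n m t) k) =
      2 * fact (n - 2) / (fact (m - 1) * fact (n - m - 1))"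
    by simp
qed

end
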